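(* Let $B$ be a complex Banach space and let $\rho\colon\mathbb S\to B$ satisfy $\sum_{\lambda\in\mathbb S}\|\rho(\lambda)\|<\infty$. Let $g=\Sigma(\rho)^+$ be the corresponding inner Poincaré simple pole series, a $B$-valued holomorphic function on $\mathbb D$. Then $g$ is uniquely rrl-continuable, and its rrl-continuation is the associated outer Poincaré simple pole series $\Sigma(\rho)^-$.
   Context: Notation: $\mathbb D=\{z\in\mathbb C: |z|<1\}$, $\mathbb E=\{z\in\mathbb C:|z|>1\}\cup\{\infty\}\subset\widehat{\mathbb C}$, $\mathbb S=\{z\in\mathbb C:|z|=1\}$. PSP-series: for $\rho\colon\mathbb S\to B$ with $\sum_{\lambda\in\mathbb S}\|\rho(\lambda)\|<\infty$ (so $\rho$ has countable support), put $\Sigma(\rho)(z)=\sum_{\lambda\in\mathbb S}\frac{\rho(\lambda)}{z-\lambda}$ for $z\in\mathbb D\cup\mathbb E$ (with value $0$ at $\infty$). The inner PSP-series is $\Sigma(\rho)^+=\Sigma(\rho)|_{\mathbb D}$ and the associated outer PSP-series is $\Sigma(\rho)^-=\Sigma(\rho)|_{\mathbb E}$; both are holomorphic with values in $B$. Right limits: a right limit of a bounded sequence $(a_k)_{k\ge0}$ in $B$ is a two-sided sequence $(b_n)_{n\in\mathbb Z}$ in $B$ for which there is a strictly increasing sequence of positive integers $(k_j)_{j\ge1}$ with $\lim_{j\to\infty}a_{n+k_j}=b_n$ (in norm) for every $n\in\mathbb Z$. It is renascent if $b_n=a_n$ for all $n\ge0$. rrl-continuation: a holomorphic function $g(z)=\sum_{k\ge0}a_kz^k$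 on $\mathbb D$ with values in $B$ and with bounded $(a_k)$ is rrl-continuable if $(a_k)$ has a renascent right limit $(b_n)_{n\in\mathbb Z}$; then the function $z\mapsto-\sum_{n<0}b_nz^n$ on $\mathbb E$ is called an rrl-continuation of $g$. The function $g$ is uniquely rrl-continuable if it has exactly one rrl-continuation. *)

theory Defs
  imports "HOL-Analysis.Analysis"
begin

text \<open>Complex Banach spaces: the library only has real ones. The unit law for complex scalars
  follows from compatibility with the real scalar multiplication.\<close>

class complex_banach = banach +
  fixes scaleC :: "complex \<Rightarrow> 'a \<Rightarrow> 'a"  (infixr "*\<^sub>C" 75)
  assumes scaleC_add_right: "c *\<^sub>C (x + y) = c *\<^sub>C x + c *\<^sub>C y"
    and scaleC_add_left: "(c + d) *\<^sub>C x = c *\<^sub>C x + d *\<^sub>C x"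
    and scaleC_scaleC: "c *\<^sub>C d *\<^sub>C x = (c * d) *\<^sub>C x"
    and scaleC_of_real: "complex_of_real r *\<^sub>C x = r *\<^sub>R x"
    and norm_scaleC: "norm (c *\<^sub>C x) = cmod c * norm x"

instantiation complex :: complex_banach
begin

definition scaleC_complex :: "complex \<Rightarrow> complex \<Rightarrow> complex" where
  "scaleC_complex c x = c * x"

instance
  by standard (auto simp: scaleC_complex_def algebra_simps norm_mult scaleR_conv_of_real)

end

text \<open>The Riemann sphere is represented by the type \<^typ>\<open>complex option\<close>, with \<^term>\<open>None\<close> for
  the point at infinity. A function whose domain is a subset \<open>A\<close> is represented by its
  extensional representative (\<^term>\<open>restrict f A\<close>), so that equality of functions is equality
  on \<open>A\<close>.\<close>

definition unit_disc :: "complex set" where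
  "unit_disc = {z. norm z < 1}"

definition unit_circle :: "complex set" where
  "unit_circle = {z. norm z = 1}"

definition outer_disc :: "complex option set" where
  "outer_disc = insert None (Some ` {z. norm z > 1})"

definition holomorphic_into :: "(complex \<Rightarrow> 'b::complex_banach) \<Rightarrow> complex set \<Rightarrow> bool" where
  "holomorphic_into f S \<longleftrightarrow>
     (\<forall>z\<in>S. \<exists>d. ((\<lambda>w. inverse (w - z) *\<^sub>C (f w - f z)) \<longlongrightarrow> d) (at z within S))"


text \<open>Only the values of \<open>\<rho>\<close> on the unit circle matter below.\<close>

definition psp_series :: "(complex \<Rightarrow> 'b::complex_banach) \<Rightarrow> complex option \<Rightarrow> 'b" where
  "psp_series \<rho> p = (case p of
     None \<Rightarrow> 0
   | Some z \<Rightarrow> (\<Sum>\<^sub>\<infinity>l\<in>unit_circle. inverse (z - l) *\<^sub>C \<rho> l))"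

definition inner_psp_series :: "(complex \<Rightarrow> 'b::complex_banach) \<Rightarrow> complex \<Rightarrow> 'b" where
  "inner_psp_series \<rho> = restrict (\<lambda>z. psp_series \<rho> (Some z)) unit_disc"

definition outer_psp_series :: "(complex \<Rightarrow> 'b::complex_banach) \<Rightarrow> complex option \<Rightarrow> 'b" where
  "outer_psp_series \<rho> = restrict (psp_series \<rho>) outer_disc"


text \<open>For fixed \<open>n\<close>, the index \<open>n + k j\<close> is nonnegative for all large \<open>j\<close>, so the truncation by
  \<^const>\<open>nat\<close> does not affect the limit.\<close>

definition right_limit :: "(nat \<Rightarrow> 'b::complex_banach) \<Rightarrow> (int \<Rightarrow> 'b) \<Rightarrow> bool" where
  "right_limit a b \<longleftrightarrow> bounded (range a) \<and>
     (\<exists>k::nat \<Rightarrow> nat. strict_mono k \<and> (\<forall>j. k j > 0) \<and>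
        (\<forall>n::int. (\<lambda>j. a (nat (n + int (k j)))) \<longlonglongrightarrow> b n))"

definition renascent_right_limit :: "(nat \<Rightarrow> 'b::complex_banach) \<Rightarrow> (int \<Rightarrow> 'b) \<Rightarrow> bool" where
  "renascent_right_limit a b \<longleftrightarrow> right_limit a b \<and> (\<forall>n::nat. b (int n) = a n)"

text \<open>At infinity every term \<open>b n * z ^ n\<close> with \<open>n < 0\<close> vanishes.\<close>

definition outer_function :: "(int \<Rightarrow> 'b::complex_banach) \<Rightarrow> complex option \<Rightarrow> 'b" where
  "outer_function b = restrict (\<lambda>p. case p of
     None \<Rightarrow> 0
   | Some z \<Rightarrow> - (\<Sum>\<^sub>\<infinity>n\<in>{..<0::int}. (z powi n) *\<^sub>C b n)) outer_disc"

definition rrl_continuation ::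
    "(complex \<Rightarrow> 'b::complex_banach) \<Rightarrow> (complex option \<Rightarrow> 'b) \<Rightarrow> bool" where
  "rrl_continuation g h \<longleftrightarrow>
     holomorphic_into g unit_disc \<and>
     (\<exists>a b. bounded (range a) \<and>
        (\<forall>z\<in>unit_disc. (\<lambda>k. (z ^ k) *\<^sub>C a k) sums g z) \<and>
        renascent_right_limit a b \<and> h = outer_function b)"

definition rrl_continuable :: "(complex \<Rightarrow> 'b::complex_banach) \<Rightarrow> bool" where
  "rrl_continuable g \<longleftrightarrow> (\<exists>h. rrl_continuation g h)"

definition uniquely_rrl_continuable :: "(complex \<Rightarrow> 'b::complex_banach) \<Rightarrow> bool" where
  "uniquely_rrl_continuable g \<longleftrightarrow> rrl_continuable g \<and> (\<exists>!h. rrl_continuation g h)"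

end

theory Submission
  imports Defs
begin

text \<open>The Taylor coefficients of \<open>\<Sigma>(\<rho>)\<^sup>+\<close> are the restriction to \<open>n \<ge> 0\<close> of the two-sided sequence
  \<open>b\<^sub>n = - \<Sum>\<^sub>\<lambda> \<lambda>\<^bsup>-n-1\<^esup> \<rho>(\<lambda>)\<close>, whose negative part generates \<open>\<Sigma>(\<rho>)\<^sup>-\<close>. By compactness of the
  circle, finitely many unimodular numbers have arbitrarily large common powers near 1, so \<open>b\<close> is
  uniformly almost periodic and hence a right limit of its own nonnegative part. If \<open>b'\<close> is another
  renascent right limit, an almost period \<open>m > -n\<close> gives
  \<open>b'\<^sub>n \<approx> b'\<^bsub>n+m\<^esub> = b\<^bsub>n+m\<^esub> \<approx> b\<^sub>n\<close>.\<close>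

text \<open>Over the real scalars, complex scaling is a bounded bilinear map. This supplies the
  rules for zero, differences, finite sums and infinite sums used throughout. Compatibility with a
  real factor \<open>r\<close> follows by treating \<open>r\<close> as a complex number.\<close>

interpretation scaleC: bounded_bilinear "scaleC :: complex \<Rightarrow> 'b::complex_banach \<Rightarrow> 'b"
proof
  fix r :: real and a a' :: complex and x y :: 'b
  show "(a + a') *\<^sub>C x = a *\<^sub>C x + a' *\<^sub>C x" "a *\<^sub>C (x + y) = a *\<^sub>C x + a *\<^sub>C y"
    by (rule scaleC_add_left scaleC_add_right)+
  show "(r *\<^sub>R a) *\<^sub>C x = r *\<^sub>R (a *\<^sub>C x)" "a *\<^sub>C (r *\<^sub>R x) = r *\<^sub>R (a *\<^sub>C x)"
    unfolding scaleR_conv_of_real[of r a]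
    by (simp_all only: scaleC_of_real[symmetric] scaleC_scaleC mult.commute)
  show "\<exists>K. \<forall>(a::complex) (x::'b). norm (a *\<^sub>C x) \<le> norm a * norm x * K"
    by (rule exI[of _ 1]) (simp add: norm_scaleC)
qed

section \<open>Uniqueness of power series coefficients\<close>

text \<open>Strong induction: once the coefficients below \<open>n\<close> vanish, division by
  \<open>r ^ n\<close> at a real radius \<open>r\<close> leaves \<open>c n\<close> equal to minus a
  tail. Boundedness makes that tail O(r), and letting \<open>r\<close> tend to 0 gives the
  claim.\<close>

lemma power_series_zero:
  fixes c :: "nat \<Rightarrow> 'b::complex_banach"
  assumes "bounded (range c)" and sums0: "\<And>z. norm z < 1 \<Longrightarrow> (\<lambda>k. z ^ k *\<^sub>C c k) sums 0"
  shows "c n = 0"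
proof (induction n rule: less_induct)
  case (less n)
  obtain M where M: "\<And>k. norm (c k) \<le> M"
    using assms(1) by (auto simp: bounded_iff)
  have bound: "norm (c n) \<le> r * (M / (1 - r))" if "0 < r" "r < 1" for r :: real
  proof -
    \<comment> \<open>The terms with index below \<open>n\<close> are zero by the induction
      hypothesis, so shifting the index does not change the sum.\<close>
    have "(\<lambda>k. complex_of_real r ^ (k + n) *\<^sub>C c (k + n)) sums 0"
      using sums_iff_shift[of "\<lambda>k. complex_of_real r ^ k *\<^sub>C c k" n 0]
        sums0[of "complex_of_real r"] less that by (simp add: scaleC.zero_right)
    then have "(\<lambda>k. r ^ (k + n) *\<^sub>R c (k + n)) sums 0"
      by (simp flip: of_real_power of_real_mult add: scaleC_of_real)
    from sums_scaleR_right[OF this, of "inverse (r ^ n)"]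
    have "(\<lambda>k. r ^ k *\<^sub>R c (k + n)) sums 0"
      using that by (simp add: power_add field_simps)
    then have tail: "(\<lambda>k. r ^ Suc k *\<^sub>R c (Suc k + n)) sums (- c n)"
      using sums_Suc_iff[of "\<lambda>k. r ^ k *\<^sub>R c (k + n)" "- c n"] by simp
    have geo: "(\<lambda>k. r * (M * r ^ k)) sums (r * (M * (1 / (1 - r))))"
      using that by (intro sums_mult geometric_sums) auto
    have le: "norm (r ^ Suc k *\<^sub>R c (Suc k + n)) \<le> r * (M * r ^ k)" for k
      using M[of "Suc k + n"] that by (simp add: mult_left_mono mult_ac)
    have "norm (- c n) \<le> (\<Sum>k. r * (M * r ^ k))"
      using norm_suminf_le[OF le sums_summable[OF geo]] unfolding sums_unique[OF tail] .
    then show ?thesis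
      using geo by (simp add: sums_iff)
  qed
  have "((\<lambda>r. r * (M / (1 - r))) \<longlongrightarrow> 0) (at_right (0::real))"
    by (auto intro!: tendsto_eq_intros)
  moreover have "\<forall>\<^sub>F r in at_right (0::real). norm (c n) \<le> r * (M / (1 - r))"
    using eventually_at_right_real[of 0 1] by (rule eventually_mono) (use bound in auto)
  ultimately have "norm (c n) \<le> 0"
    by (rule tendsto_lowerbound) simp
  then show ?case by simp
qed

lemma power_series_unique:
  fixes a a' :: "nat \<Rightarrow> 'b::complex_banach"
  assumes "bounded (range a)" "bounded (range a')"
    and "\<And>z. norm z < 1 \<Longrightarrow> (\<lambda>k. z ^ k *\<^sub>C a k) sums g z"
    and "\<And>z. norm z < 1 \<Longrightarrow> (\<lambda>k. z ^ k *\<^sub>C a' k) sums g z"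
  shows "a = a'"
proof
  fix n
  have "a n - a' n = 0"
  proof (rule power_series_zero[of "\<lambda>n. a n - a' n"])
    show "bounded (range (\<lambda>n. a n - a' n))"
      using assms(1,2) by (rule bounded_minus_comp)
    show "(\<lambda>k. z ^ k *\<^sub>C (a k - a' k)) sums 0" if "norm z < 1" for z
      using sums_diff[OF assms(3,4)[OF that]] by (simp add: scaleC.diff_right)
  qed
  then show "a n = a' n" by simp
qed

section \<open>Simultaneous recurrence of unimodular powers\<close>

text \<open>Bolzano-Weierstrass is applied to one element of \<open>F\<close> at a time. Refining
  the subsequence for a new element preserves the convergence already obtained.\<close>

lemma unimodular_powers_convergent_subseq:
  assumes "finite F" "F \<subseteq> unit_circle"
  shows "\<exists>r::nat \<Rightarrow> nat. strict_mono r \<and> (\<forall>l\<in>F. convergent (\<lambda>j. l ^ r j))"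
  using assms
proof (induction F rule: finite_induct)
  case empty
  then show ?case using strict_mono_id by blast
next
  case (insert x F)
  then obtain r :: "nat \<Rightarrow> nat"
    where r: "strict_mono r" "\<And>l. l \<in> F \<Longrightarrow> convergent (\<lambda>j. l ^ r j)"
    by auto
  have "bounded (range (\<lambda>j. x ^ r j))"
    using insert.prems by (auto simp: bounded_iff unit_circle_def norm_power intro!: exI[of _ 1])
  then obtain l s where s: "strict_mono (s :: nat \<Rightarrow> nat)" "((\<lambda>j. x ^ r j) \<circ> s) \<longlonglongrightarrow> l"
    using bounded_imp_convergent_subsequence by blast
  have "convergent (\<lambda>j. y ^ (r \<circ> s) j)" if "y \<in> insert x F" for y
  proof (cases "y = x")
    case True
    then show ?thesis using s(2) by (auto simp: convergent_def o_def)
  next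
    case False
    then show ?thesis
      using convergent_subseq_convergent[OF r(2) s(1), of y] that by (simp add: o_def)
  qed
  then show ?case using strict_mono_o[OF r(1) s(1)] by blast
qed

text \<open>Convergent powers are Cauchy, and for |l| = 1 the distance between
  \<open>l ^ r i\<close> and \<open>l ^ r K\<close> equals that between
  \<open>l ^ (r i - r K)\<close> and 1. Differences of exponents therefore serve as common
  near-periods.\<close>

lemma unimodular_powers_near_one:
  fixes N :: nat
  assumes "finite F" "F \<subseteq> unit_circle" "e > 0"
  shows "\<exists>m>N. \<forall>l\<in>F. norm (l ^ m - 1) < e"
proof -
  obtain r :: "nat \<Rightarrow> nat"
    where r: "strict_mono r" "\<And>l. l \<in> F \<Longrightarrow> convergent (\<lambda>j. l ^ r j)"
    using unimodular_powers_convergent_subseq[OF assms(1,2)] by blast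
  have "\<forall>l\<in>F. \<exists>J. \<forall>i\<ge>J. \<forall>j\<ge>J. norm (l ^ r i - l ^ r j) < e"
    using r(2) assms(3) by (metis CauchyD convergent_Cauchy)
  then obtain J where J: "\<And>l i j. \<lbrakk>l \<in> F; i \<ge> J l; j \<ge> J l\<rbrakk> \<Longrightarrow> norm (l ^ r i - l ^ r j) < e"
    by metis
  obtain K where K: "\<And>l. l \<in> F \<Longrightarrow> J l \<le> K"
    using finite_nat_set_iff_bounded_le[of "J ` F"] assms(1) by auto
  \<comment> \<open>Since \<open>r i \<ge> i\<close>, this index makes \<open>r i - r K\<close>
    exceed \<open>N\<close>, and it also lies beyond the common Cauchy threshold
    \<open>K\<close>.\<close>
  define i where "i = K + r K + N + 1"
  have i: "i \<ge> K" "r i \<ge> r K + N + 1"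
    using seq_suble[OF r(1), of i] by (auto simp: i_def)
  have "norm (l ^ (r i - r K) - 1) < e" if "l \<in> F" for l
  proof -
    have l: "norm l = 1" using that assms(2) by (auto simp: unit_circle_def)
    have "l ^ r i = l ^ r K * l ^ (r i - r K)"
      using i(2) by (simp flip: power_add)
    then have "l ^ r i - l ^ r K = l ^ r K * (l ^ (r i - r K) - 1)"
      by (simp add: right_diff_distrib)
    then have "norm (l ^ r i - l ^ r K) = norm (l ^ (r i - r K) - 1)"
      using l by (simp add: norm_mult norm_power)
    then show ?thesis using J[OF that, of i K] K[OF that] i by auto
  qed
  moreover have "r i - r K > N" using i by simp
  ultimately show ?thesis by blast
qed

section \<open>Integration of scalar functions against \<rho>\<close>

text \<open>This is the integral of \<open>f\<close> against the vector-valued atomic measure with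
  mass \<open>\<rho> l\<close> at \<open>l\<close>. The series, its coefficients and its derivative
  are all such integrals, which reduces their identities and estimates to scalar functions on the
  circle.\<close>

definition circle_pairing :: "(complex \<Rightarrow> 'b::complex_banach) \<Rightarrow> (complex \<Rightarrow> complex) \<Rightarrow> 'b" where
  "circle_pairing \<rho> f = (\<Sum>\<^sub>\<infinity>l\<in>unit_circle. f l *\<^sub>C \<rho> l)"

text \<open>The geometric expansions of 1/(z - l) for |z| < 1 and, up to sign, for |z| > 1 have the
  same coefficient formula, for n \<ge> 0 and n < 0 respectively. Hence one two-sided sequence
  covers both domains.\<close>

definition psp_coeff :: "(complex \<Rightarrow> 'b::complex_banach) \<Rightarrow> int \<Rightarrow> 'b" where
  "psp_coeff \<rho> n = circle_pairing \<rho> (\<lambda>l. - (l powi (- n - 1)))"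

lemma circle_pairing_cong:
  "(\<And>l. l \<in> unit_circle \<Longrightarrow> f l = g l) \<Longrightarrow> circle_pairing \<rho> f = circle_pairing \<rho> g"
  unfolding circle_pairing_def by (rule infsum_cong) simp

lemma psp_series_eq_circle_pairing:
  "psp_series \<rho> (Some z) = circle_pairing \<rho> (\<lambda>l. inverse (z - l))"
  by (simp add: psp_series_def circle_pairing_def)

context
  fixes \<rho> :: "complex \<Rightarrow> 'b::complex_banach"
  assumes summable: "(\<lambda>l. norm (\<rho> l)) summable_on unit_circle"
begin

lemma circle_pairing_abs_summable:
  assumes "\<And>l. l \<in> unit_circle \<Longrightarrow> norm (f l) \<le> C"
  shows "(\<lambda>l. norm (f l *\<^sub>C \<rho> l)) summable_on unit_circle"
proof (rule summable_on_comparison_test)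
  show "(\<lambda>l. C * norm (\<rho> l)) summable_on unit_circle"
    by (intro summable_on_cmult_right summable)
  show "norm (f l *\<^sub>C \<rho> l) \<le> C * norm (\<rho> l)" if "l \<in> unit_circle" for l
    using assms[OF that] by (simp add: norm_scaleC mult_right_mono)
qed auto

lemma circle_pairing_has_sum:
  assumes "\<And>l. l \<in> unit_circle \<Longrightarrow> norm (f l) \<le> C"
  shows "((\<lambda>l. f l *\<^sub>C \<rho> l) has_sum circle_pairing \<rho> f) unit_circle"
  unfolding circle_pairing_def
  using circle_pairing_abs_summable[OF assms] by (rule has_sum_infsum[OF abs_summable_summable])

text \<open>The weight \<open>norm (f l)\<close> stays inside the sum because almost periodicity
  involves functions that are controlled to be small only on a finite set and are merely bounded
  elsewhere.\<close>

lemma norm_circle_pairing_le_infsum: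
  assumes "\<And>l. l \<in> unit_circle \<Longrightarrow> norm (f l) \<le> C"
  shows "norm (circle_pairing \<rho> f) \<le> (\<Sum>\<^sub>\<infinity>l\<in>unit_circle. norm (f l) * norm (\<rho> l))"
  using norm_infsum_bound[OF circle_pairing_abs_summable[OF assms]]
  by (simp add: circle_pairing_def norm_scaleC)

lemma norm_circle_pairing_le:
  assumes "\<And>l. l \<in> unit_circle \<Longrightarrow> norm (f l) \<le> C"
  shows "norm (circle_pairing \<rho> f) \<le> C * (\<Sum>\<^sub>\<infinity>l\<in>unit_circle. norm (\<rho> l))"
proof -
  have "(\<Sum>\<^sub>\<infinity>l\<in>unit_circle. norm (f l) * norm (\<rho> l)) \<le> (\<Sum>\<^sub>\<infinity>l\<in>unit_circle. C * norm (\<rho> l))"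
    using circle_pairing_abs_summable[of f C] assms summable
    by (intro infsum_mono summable_on_cmult_right) (auto simp: norm_scaleC mult_right_mono)
  also have "\<dots> = C * (\<Sum>\<^sub>\<infinity>l\<in>unit_circle. norm (\<rho> l))"
    by (rule infsum_cmult_right) (use summable in simp)
  finally show ?thesis using norm_circle_pairing_le_infsum[of f C] assms by simp
qed

lemma circle_pairing_diff:
  assumes "\<And>l. l \<in> unit_circle \<Longrightarrow> norm (f l) \<le> C" "\<And>l. l \<in> unit_circle \<Longrightarrow> norm (g l) \<le> D"
  shows "circle_pairing \<rho> (\<lambda>l. f l - g l) = circle_pairing \<rho> f - circle_pairing \<rho> g"
proof -
  have "((\<lambda>l. f l *\<^sub>C \<rho> l + - (g l *\<^sub>C \<rho> l))
      has_sum (circle_pairing \<rho> f + - circle_pairing \<rho> g)) unit_circle"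
    using assms
    by (intro has_sum_add has_sum_uminus[THEN iffD2]) (auto intro: circle_pairing_has_sum)
  then show ?thesis
    by (simp add: circle_pairing_def scaleC.diff_left infsumI)
qed

lemma circle_pairing_scale:
  assumes "\<And>l. l \<in> unit_circle \<Longrightarrow> norm (f l) \<le> C"
  shows "circle_pairing \<rho> (\<lambda>l. c * f l) = c *\<^sub>C circle_pairing \<rho> f"
  using infsumI[OF has_sum_bounded_linear[OF scaleC.bounded_linear_right[of c]
      circle_pairing_has_sum[of f C]]] assms
  by (simp add: circle_pairing_def scaleC_scaleC)

lemma circle_pairing_sum:
  assumes "finite I" "\<And>i l. \<lbrakk>i \<in> I; l \<in> unit_circle\<rbrakk> \<Longrightarrow> norm (f i l) \<le> C"
  shows "circle_pairing \<rho> (\<lambda>l. \<Sum>i\<in>I. f i l) = (\<Sum>i\<in>I. circle_pairing \<rho> (f i))"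
proof -
  have "((\<lambda>l. \<Sum>i\<in>I. f i l *\<^sub>C \<rho> l) has_sum (\<Sum>i\<in>I. circle_pairing \<rho> (f i))) unit_circle"
    using assms
    by (induction I rule: finite_induct) (auto intro!: has_sum_add circle_pairing_has_sum)
  then show ?thesis
    by (simp add: circle_pairing_def[of \<rho> "\<lambda>l. \<Sum>i\<in>I. f i l"] scaleC.sum_left infsumI)
qed

text \<open>Summation and pairing are interchanged through the finite geometric sum: the remainder
  after \<open>N\<close> terms is the pairing with \<open>h l / (1 - u l) * u l ^ N\<close>, which
  is O(\<open>q ^ N\<close>). The ratio \<open>u l\<close> will be z/l inside the disc and l/z
  outside.\<close>

lemma circle_pairing_geometric:
  assumes h: "\<And>l. l \<in> unit_circle \<Longrightarrow> norm (h l) \<le> C"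
    and u: "\<And>l. l \<in> unit_circle \<Longrightarrow> norm (u l) \<le> q" and "0 \<le> q" "q < 1"
  shows "(\<lambda>k. circle_pairing \<rho> (\<lambda>l. h l * u l ^ k)) sums circle_pairing \<rho> (\<lambda>l. h l / (1 - u l))"
proof -
  define A where "A = (\<Sum>\<^sub>\<infinity>l\<in>unit_circle. norm (\<rho> l))"
  \<comment> \<open>The bound \<open>h\<close> is read off at the point 1 of the circle.\<close>
  have C: "C \<ge> 0" using order.trans[OF norm_ge_zero h[of 1]] by (simp add: unit_circle_def)
  have term_bound: "norm (h l * u l ^ k) \<le> C" if "l \<in> unit_circle" for l k
  proof -
    have "norm (u l) ^ k \<le> 1"
      using u[OF that] \<open>q < 1\<close> by (intro power_le_one) auto
    then have "norm (h l) * norm (u l) ^ k \<le> C * 1"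
      using h[OF that] C by (intro mult_mono) auto
    then show ?thesis by (simp add: norm_mult norm_power)
  qed
  have quot_bound: "norm (h l / (1 - u l)) \<le> C / (1 - q)" if "l \<in> unit_circle" for l
  proof -
    have "1 - q \<le> norm (1 - u l)"
      using u[OF that] norm_triangle_ineq2[of 1 "u l"] by simp
    then show ?thesis
      using h[OF that] \<open>q < 1\<close> C by (simp add: norm_divide frac_le)
  qed
  have rem_bound: "norm (h l / (1 - u l) * u l ^ N) \<le> C / (1 - q) * q ^ N"
    if "l \<in> unit_circle" for l N
    unfolding norm_mult norm_power
    using quot_bound[OF that] u[OF that] C \<open>q < 1\<close> \<open>0 \<le> q\<close>
    by (intro mult_mono power_mono) auto
  have "norm ((\<Sum>k<N. circle_pairing \<rho> (\<lambda>l. h l * u l ^ k))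
      - circle_pairing \<rho> (\<lambda>l. h l / (1 - u l))) \<le> C / (1 - q) * q ^ N * A" for N
  proof -
    \<comment> \<open>A bound depending on \<open>N\<close> is enough here: it only justifies
      splitting the pairing of a difference.\<close>
    have sum_bound: "norm (\<Sum>k<N. h l * u l ^ k) \<le> real N * C" if "l \<in> unit_circle" for l
      using sum_norm_bound[of "{..<N}" "\<lambda>k. h l * u l ^ k" C] term_bound[OF that] by simp
    have "circle_pairing \<rho> (\<lambda>l. h l / (1 - u l)) - (\<Sum>k<N. circle_pairing \<rho> (\<lambda>l. h l * u l ^ k))
        = circle_pairing \<rho> (\<lambda>l. h l / (1 - u l)) - circle_pairing \<rho> (\<lambda>l. \<Sum>k<N. h l * u l ^ k)"
      using term_bound by (subst circle_pairing_sum) auto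
    also have "\<dots> = circle_pairing \<rho> (\<lambda>l. h l / (1 - u l) - (\<Sum>k<N. h l * u l ^ k))"
      using quot_bound sum_bound by (rule circle_pairing_diff[symmetric])
    also have "\<dots> = circle_pairing \<rho> (\<lambda>l. h l / (1 - u l) * u l ^ N)"
    proof (rule circle_pairing_cong)
      fix l assume "l \<in> unit_circle"
      then have "u l \<noteq> 1" using u[of l] \<open>q < 1\<close> by auto
      then have "(\<Sum>k<N. h l * u l ^ k) = h l * ((1 - u l ^ N) / (1 - u l))"
        by (simp add: sum_gp_strict flip: sum_distrib_left)
      then show "h l / (1 - u l) - (\<Sum>k<N. h l * u l ^ k) = h l / (1 - u l) * u l ^ N"
        by (simp add: right_diff_distrib diff_divide_distrib)
    qed
    finally show ?thesis
      using norm_circle_pairing_le[of "\<lambda>l. h l / (1 - u l) * u l ^ N", OF rem_bound]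
      by (simp add: A_def norm_minus_commute)
  qed
  moreover have "(\<lambda>N. C / (1 - q) * q ^ N * A) \<longlonglongrightarrow> 0"
    using \<open>0 \<le> q\<close> \<open>q < 1\<close>
    by (intro tendsto_mult_left_zero tendsto_mult_right_zero LIMSEQ_realpow_zero)
  ultimately have "(\<lambda>N. (\<Sum>k<N. circle_pairing \<rho> (\<lambda>l. h l * u l ^ k))
      - circle_pairing \<rho> (\<lambda>l. h l / (1 - u l))) \<longlonglongrightarrow> 0"
    by (rule Lim_null_comparison[OF always_eventually, rule_format])
  then show ?thesis
    unfolding sums_def by (rule LIM_zero_cancel)
qed

section \<open>Expansions of the inner and outer series\<close>

lemma norm_psp_coeff_le: "norm (psp_coeff \<rho> n) \<le> (\<Sum>\<^sub>\<infinity>l\<in>unit_circle. norm (\<rho> l))"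
  unfolding psp_coeff_def
  using norm_circle_pairing_le[of "\<lambda>l. - (l powi (- n - 1))" 1]
  by (simp add: unit_circle_def norm_power_int)

lemma bounded_psp_coeff: "bounded (range (\<lambda>k. psp_coeff \<rho> (int k)))"
  using norm_psp_coeff_le by (auto simp: bounded_iff)

text \<open>Write 1/(z - l) as -(1/l)/(1 - z/l) and expand in powers of z/l, whose modulus is |z| <
  1.\<close>

lemma psp_coeff_sums:
  assumes "norm z < 1"
  shows "(\<lambda>k. z ^ k *\<^sub>C psp_coeff \<rho> (int k)) sums psp_series \<rho> (Some z)"
proof -
  have "(\<lambda>k. circle_pairing \<rho> (\<lambda>l. - inverse l * (z / l) ^ k))
      sums circle_pairing \<rho> (\<lambda>l. - inverse l / (1 - z / l))"
    using assms
    by (intro circle_pairing_geometric[where C = 1 and q = "norm z"])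
      (auto simp: unit_circle_def norm_inverse norm_divide)
  moreover have "circle_pairing \<rho> (\<lambda>l. - inverse l * (z / l) ^ k)
      = z ^ k *\<^sub>C psp_coeff \<rho> (int k)" for k
  proof -
    have "circle_pairing \<rho> (\<lambda>l. - inverse l * (z / l) ^ k)
        = circle_pairing \<rho> (\<lambda>l. z ^ k * - (l powi (- int k - 1)))"
    proof (rule circle_pairing_cong)
      fix l assume "l \<in> unit_circle"
      then have "l \<noteq> 0" by (auto simp: unit_circle_def)
      then show "- inverse l * (z / l) ^ k = z ^ k * - (l powi (- int k - 1))"
        by (simp add: power_int_diff power_int_minus power_divide field_simps)
    qed
    also have "\<dots> = z ^ k *\<^sub>C psp_coeff \<rho> (int k)"
      unfolding psp_coeff_def
      by (rule circle_pairing_scale[where C = 1]) (simp add: unit_circle_def norm_power_int)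
    finally show ?thesis .
  qed
  moreover have "circle_pairing \<rho> (\<lambda>l. - inverse l / (1 - z / l)) = psp_series \<rho> (Some z)"
    unfolding psp_series_eq_circle_pairing
  proof (rule circle_pairing_cong)
    fix l assume "l \<in> unit_circle"
    then have "l \<noteq> 0" "l \<noteq> z" using assms by (auto simp: unit_circle_def)
    then show "- inverse l / (1 - z / l) = inverse (z - l)"
      by (simp add: divide_simps)
  qed
  ultimately show ?thesis by simp
qed

text \<open>Write -1/(z - l) as -(1/z)/(1 - l/z) and expand in powers of l/z, of modulus 1/|z| < 1.
  The sign left over is cancelled by the minus in \<open>outer_function\<close>, and at infinity
  both sides are 0.\<close>

lemma outer_function_psp_coeff: "outer_function (psp_coeff \<rho>) = outer_psp_series \<rho>"
proof -
  have eq: "- (\<Sum>\<^sub>\<infinity>n\<in>{..<0::int}. z powi n *\<^sub>C psp_coeff \<rho> n) = psp_series \<rho> (Some z)"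
    if z: "norm z > 1" for z
  proof -
    \<comment> \<open>The negative indices are enumerated as \<open>- int k - 1\<close> with
      \<open>k \<ge> 0\<close>.\<close>
    define t where "t k = z powi (- int k - 1) *\<^sub>C psp_coeff \<rho> (- int k - 1)" for k
    define A where "A = (\<Sum>\<^sub>\<infinity>l\<in>unit_circle. norm (\<rho> l))"
    have z0: "z \<noteq> 0" using z by auto
    have "(\<lambda>k. circle_pairing \<rho> (\<lambda>l. - inverse z * (l / z) ^ k))
        sums circle_pairing \<rho> (\<lambda>l. - inverse z / (1 - l / z))"
      using z
      by (intro circle_pairing_geometric[where C = "norm (inverse z)" and q = "inverse (norm z)"])
        (auto simp: unit_circle_def norm_mult norm_inverse divide_inverse inverse_less_1_iff)
    moreover have "circle_pairing \<rho> (\<lambda>l. - inverse z * (l / z) ^ k) = t k" for k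
    proof -
      have "circle_pairing \<rho> (\<lambda>l. - inverse z * (l / z) ^ k)
          = circle_pairing \<rho> (\<lambda>l. z powi (- int k - 1) * - (l powi (- (- int k - 1) - 1)))"
        using z0
        by (intro circle_pairing_cong)
          (simp add: power_int_diff power_int_minus power_divide field_simps)
      also have "\<dots> = t k"
        unfolding psp_coeff_def t_def
        by (rule circle_pairing_scale[where C = 1]) (simp add: unit_circle_def norm_power)
      finally show ?thesis .
    qed
    moreover have "circle_pairing \<rho> (\<lambda>l. - inverse z / (1 - l / z))
        = circle_pairing \<rho> (\<lambda>l. (-1) * inverse (z - l))"
      using z0 z
      by (intro circle_pairing_cong) (auto simp: unit_circle_def divide_simps)
    moreover have "\<dots> = - psp_series \<rho> (Some z)"
    proof -
      have "norm (inverse (z - l)) \<le> inverse (norm z - 1)" if "l \<in> unit_circle" for l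
        using that z norm_triangle_ineq2[of z l]
        by (simp add: unit_circle_def norm_inverse le_imp_inverse_le)
      then have "circle_pairing \<rho> (\<lambda>l. (-1) * inverse (z - l))
          = (-1) *\<^sub>C circle_pairing \<rho> (\<lambda>l. inverse (z - l))"
        by (rule circle_pairing_scale)
      then show ?thesis
        by (simp add: psp_series_eq_circle_pairing scaleC_of_real[of "-1", simplified])
    qed
    ultimately have t_sums: "t sums (- psp_series \<rho> (Some z))"
      by simp
    \<comment> \<open>Passing from the ordered series to the unordered sum over negative integers
      uses absolute convergence, which comes from the uniform bound on the coefficients.\<close>
    have "summable (\<lambda>k. norm (t k))"
    proof (rule summable_comparison_test')
      show "summable (\<lambda>k. A * inverse (norm z) * inverse (norm z) ^ k)"
        using z by (intro summable_mult summable_geometric) (auto simp: inverse_less_1_iff)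
      have "norm (t k) = inverse (norm z) * inverse (norm z) ^ k * norm (psp_coeff \<rho> (- int k - 1))"
        for k
        using z0
        by (simp add: t_def norm_scaleC norm_power_int power_int_diff power_int_minus
            norm_divide norm_mult norm_power field_simps)
      also have "\<dots> k \<le> inverse (norm z) * inverse (norm z) ^ k * A" for k
        unfolding A_def by (intro mult_left_mono norm_psp_coeff_le) simp
      finally show "norm (norm (t k)) \<le> A * inverse (norm z) * inverse (norm z) ^ k" for k
        by (simp add: mult_ac)
    qed
    from norm_summable_imp_has_sum[OF this t_sums]
    have "infsum t UNIV = - psp_series \<rho> (Some z)"
      by (rule infsumI)
    moreover have "bij_betw (\<lambda>k. - int k - 1) UNIV {..<0::int}"
      by (rule bij_betw_byWitness[where f' = "\<lambda>n. nat (- n - 1)"]) auto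
    then have "(\<Sum>\<^sub>\<infinity>n\<in>{..<0::int}. z powi n *\<^sub>C psp_coeff \<rho> n) = infsum t UNIV"
      unfolding t_def
      by (rule infsum_reindex_bij_betw[symmetric])
    ultimately show ?thesis by simp
  qed
  show ?thesis
    unfolding outer_function_def outer_psp_series_def
    by (rule restrict_ext) (auto simp: outer_disc_def eq psp_series_def[of \<rho> None])
qed

section \<open>Uniform almost periodicity of the coefficients\<close>

text \<open>A finite set \<open>F\<close> carries all but \<open>e / 4\<close> of the total mass. On
  \<open>F\<close> a common near-period makes the weight small; off \<open>F\<close> the weight is
  at most 2, so each region contributes at most \<open>e / 2\<close>.\<close>

lemma psp_weighted_almost_period:
  fixes N :: nat
  assumes "e > 0"
  shows "\<exists>m>N. (\<Sum>\<^sub>\<infinity>l\<in>unit_circle. norm (l ^ m - 1) * norm (\<rho> l)) \<le> e"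
proof -
  define A where "A = (\<Sum>\<^sub>\<infinity>l\<in>unit_circle. norm (\<rho> l))"
  have A: "A \<ge> 0" unfolding A_def by (rule infsum_nonneg) simp
  obtain F where F: "finite F" "F \<subseteq> unit_circle" "dist (\<Sum>l\<in>F. norm (\<rho> l)) A \<le> e / 4"
    using infsum_finite_approximation[OF summable, of "e / 4"] assms unfolding A_def by auto
  \<comment> \<open>Chosen so that \<open>d * A \<le> e / 2\<close>; using \<open>A + 1\<close>
    keeps the denominator positive when \<open>A = 0\<close>.\<close>
  define d where "d = e / (2 * (A + 1))"
  have d: "d > 0" using assms A by (simp add: d_def)
  obtain m where m: "m > N" "\<And>l. l \<in> F \<Longrightarrow> norm (l ^ m - 1) < d"
    using unimodular_powers_near_one[OF F(1,2) d] by blast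
  have le2: "norm (l ^ m - 1) \<le> 2" if "l \<in> unit_circle" for l
    using norm_triangle_ineq4[of "l ^ m" 1] that by (simp add: unit_circle_def norm_power)
  define s where "s l = norm (l ^ m - 1) * norm (\<rho> l)" for l
  have s: "s summable_on unit_circle"
    using circle_pairing_abs_summable[OF le2] by (simp add: s_def[abs_def] norm_scaleC)
  have tail: "(\<Sum>\<^sub>\<infinity>l\<in>unit_circle - F. norm (\<rho> l)) = A - (\<Sum>l\<in>F. norm (\<rho> l))"
    using infsum_Diff[OF summable _ F(2)] F(1) by (simp add: A_def)
  have "infsum s unit_circle = sum s F + infsum s (unit_circle - F)"
    using infsum_Diff[OF s _ F(2)] F(1) by simp
  also have "sum s F \<le> (\<Sum>l\<in>F. d * norm (\<rho> l))"
    unfolding s_def using m(2) by (intro sum_mono mult_right_mono) (auto intro: less_imp_le)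
  also have "\<dots> \<le> d * A"
    unfolding sum_distrib_left[symmetric] A_def
    using d summable F by (intro mult_left_mono finite_sum_le_infsum) auto
  also have "\<dots> \<le> e / 2"
    using A assms by (simp add: d_def field_simps)
  also have "infsum s (unit_circle - F) \<le> (\<Sum>\<^sub>\<infinity>l\<in>unit_circle - F. 2 * norm (\<rho> l))"
    using s summable le2
    by (intro infsum_mono summable_on_cmult_right)
      (auto intro: summable_on_subset_banach mult_right_mono simp: s_def)
  also have "\<dots> = 2 * (\<Sum>\<^sub>\<infinity>l\<in>unit_circle - F. norm (\<rho> l))"
    by (rule infsum_cmult_right')
  also have "\<dots> \<le> e / 2"
    using abs_le_D2[OF F(3)[unfolded dist_real_def]] by (simp add: tail)
  finally show ?thesis using m(1) unfolding s_def by (intro exI[of _ m]) auto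
qed

text \<open>Shifting the index by \<open>m\<close> changes the integrand by a unimodular factor
  times \<open>l ^ m - 1\<close>. Its modulus does not depend on \<open>n\<close>, so one
  \<open>m\<close> serves all integers \<open>n\<close>.\<close>

lemma psp_coeff_almost_period:
  fixes N :: nat
  assumes "e > 0"
  shows "\<exists>m>N. \<forall>n. norm (psp_coeff \<rho> (n + int m) - psp_coeff \<rho> n) \<le> e"
proof -
  obtain m where m: "m > N" "(\<Sum>\<^sub>\<infinity>l\<in>unit_circle. norm (l ^ m - 1) * norm (\<rho> l)) \<le> e"
    using psp_weighted_almost_period[OF assms] by blast
  have "norm (psp_coeff \<rho> (n + int m) - psp_coeff \<rho> n) \<le> e" for n
  proof -
    define f where "f l = - (l powi (- (n + int m) - 1)) - - (l powi (- n - 1))" for l :: complex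
    have f: "norm (f l) = norm (l ^ m - 1)" if "l \<in> unit_circle" for l
    proof -
      have l: "norm l = 1" "l \<noteq> 0" using that by (auto simp: unit_circle_def)
      have "l powi (- n - 1) = l powi (- (n + int m) - 1) * l ^ m"
        using l(2) by (simp flip: power_int_of_nat power_int_add)
      then have "f l = l powi (- (n + int m) - 1) * (l ^ m - 1)"
        by (simp add: f_def algebra_simps)
      then show ?thesis using l by (simp add: norm_mult norm_power_int)
    qed
    have f2: "norm (f l) \<le> 2" if "l \<in> unit_circle" for l
      using norm_triangle_ineq4[of "l ^ m" 1] that f[OF that]
      by (simp add: unit_circle_def norm_power)
    have "psp_coeff \<rho> (n + int m) - psp_coeff \<rho> n = circle_pairing \<rho> f"
      unfolding psp_coeff_def f_def
      by (rule circle_pairing_diff[symmetric, where C = 1 and D = 1])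
        (auto simp: unit_circle_def norm_power_int)
    also have "norm \<dots> \<le> (\<Sum>\<^sub>\<infinity>l\<in>unit_circle. norm (f l) * norm (\<rho> l))"
      using f2 by (rule norm_circle_pairing_le_infsum)
    also have "\<dots> = (\<Sum>\<^sub>\<infinity>l\<in>unit_circle. norm (l ^ m - 1) * norm (\<rho> l))"
      by (rule infsum_cong) (simp add: f)
    finally show ?thesis using m(2) by simp
  qed
  then show ?thesis using m(1) by blast
qed

section \<open>Existence and uniqueness of the renascent right limit\<close>

text \<open>The shifts \<open>k j\<close> are increasing almost periods with error at most 1/(j+1).
  Along them the shifted sequence tends to the unshifted one, and agreement at nonnegative indices
  is built in.\<close>

lemma renascent_psp_coeff:
  "renascent_right_limit (\<lambda>k. psp_coeff \<rho> (int k)) (psp_coeff \<rho>)"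
proof -
  define P where "P j m \<longleftrightarrow> m > 0 \<and>
      (\<forall>n. norm (psp_coeff \<rho> (n + int m) - psp_coeff \<rho> n) \<le> inverse (real (Suc j)))" for j m
  have ex: "\<exists>m. P j m \<and> N < m" for j N
  proof -
    have "inverse (real (Suc j)) > 0" by simp
    from psp_coeff_almost_period[OF this, of N] obtain m where "m > N"
      "\<forall>n. norm (psp_coeff \<rho> (n + int m) - psp_coeff \<rho> n) \<le> inverse (real (Suc j))"
      by blast
    then show ?thesis unfolding P_def by (intro exI[of _ m]) simp
  qed
  have "\<exists>k. \<forall>j. P j (k j) \<and> k j < k (Suc j)"
    proof (rule dependent_nat_choice)
    show "\<exists>m. P 0 m" using ex by blast
    show "\<exists>m. P (Suc j) m \<and> N < m" for N j using ex .
  qed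
  then obtain k :: "nat \<Rightarrow> nat" where k: "\<And>j. k j > 0" "\<And>j. k j < k (Suc j)"
    "\<And>j n. norm (psp_coeff \<rho> (n + int (k j)) - psp_coeff \<rho> n) \<le> inverse (real (Suc j))"
    unfolding P_def by blast
  have mono: "strict_mono k" using k(2) by (simp add: strict_mono_Suc_iff)
  have "(\<lambda>j. psp_coeff \<rho> (int (nat (n + int (k j))))) \<longlonglongrightarrow> psp_coeff \<rho> n" for n
  proof -
    have "(\<lambda>j. psp_coeff \<rho> (n + int (k j)) - psp_coeff \<rho> n) \<longlonglongrightarrow> 0"
      using k(3) LIMSEQ_inverse_real_of_nat
      by (rule Lim_null_comparison[OF always_eventually, rule_format])
    then have "(\<lambda>j. psp_coeff \<rho> (n + int (k j))) \<longlonglongrightarrow> psp_coeff \<rho> n"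
      by (rule LIM_zero_cancel)
    \<comment> \<open>As \<open>k j \<ge> j\<close>, truncation by \<open>nat\<close> has no effect
      once \<open>j\<close> reaches \<open>- n\<close>.\<close>
    moreover have "\<forall>\<^sub>F j in sequentially.
        psp_coeff \<rho> (n + int (k j)) = psp_coeff \<rho> (int (nat (n + int (k j))))"
      using eventually_ge_at_top[of "nat (- n)"]
    proof eventually_elim
      case (elim j)
      then have "n + int (k j) \<ge> 0" using seq_suble[OF mono, of j] by linarith
      then show ?case by simp
    qed
    ultimately show ?thesis by (rule Lim_transform_eventually)
  qed
  then show ?thesis
    unfolding renascent_right_limit_def right_limit_def
    using bounded_psp_coeff mono k(1) by blast
qed

text \<open>An almost-period inequality for the coefficients passes to the limit along
  \<open>k\<close>, so \<open>b\<close> has the same almost periods. Shifting by one of them moves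
  \<open>n\<close> to a nonnegative index, where \<open>b\<close> is prescribed.\<close>

lemma renascent_psp_coeff_unique:
  assumes "renascent_right_limit (\<lambda>k. psp_coeff \<rho> (int k)) b"
  shows "b = psp_coeff \<rho>"
proof
  fix n
  obtain k :: "nat \<Rightarrow> nat" where mono: "strict_mono k"
    and lim: "\<And>n. (\<lambda>j. psp_coeff \<rho> (int (nat (n + int (k j))))) \<longlonglongrightarrow> b n"
    and nonneg: "\<And>n. b (int n) = psp_coeff \<rho> (int n)"
    using assms unfolding renascent_right_limit_def right_limit_def by blast
  have "norm (b n - psp_coeff \<rho> n) \<le> 0 + e" if "e > 0" for e
  proof -
    obtain m where m: "m > nat (- n)"
      "\<And>n. norm (psp_coeff \<rho> (n + int m) - psp_coeff \<rho> n) \<le> e / 2"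
      using psp_coeff_almost_period[of "e / 2" "nat (- n)"] \<open>e > 0\<close> half_gt_zero by blast
    have "\<forall>\<^sub>F j in sequentially. norm (psp_coeff \<rho> (int (nat (n + int m + int (k j))))
        - psp_coeff \<rho> (int (nat (n + int (k j))))) \<le> e / 2"
      using eventually_ge_at_top[of "nat (- n)"]
    proof eventually_elim
      case (elim j)
      then have "n + int (k j) \<ge> 0" using seq_suble[OF mono, of j] by linarith
      then show ?case using m(2)[of "n + int (k j)"] by (simp add: add_ac)
    qed
    then have "norm (b (n + int m) - b n) \<le> e / 2"
      by (intro tendsto_upperbound[OF tendsto_norm[OF tendsto_diff[OF lim lim]]]) auto
    moreover have "b (n + int m) = psp_coeff \<rho> (n + int m)"
      using nonneg[of "nat (n + int m)"] m(1) by (simp split: if_splits)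
    \<comment> \<open>With c = \<open>psp_coeff \<rho>\<close> and b(n+m) = c(n+m), the difference
      b(n) - c(n) equals (c(n+m) - c(n)) - (b(n+m) - b(n)), and each bracket has norm at most
      \<open>e / 2\<close>.\<close>
    ultimately show ?thesis
      using m(2)[of n] norm_triangle_ineq4[of "psp_coeff \<rho> (n + int m) - psp_coeff \<rho> n"
          "b (n + int m) - b n"] by simp
  qed
  then have "norm (b n - psp_coeff \<rho> n) \<le> 0" by (rule field_le_epsilon)
  then show "b n = psp_coeff \<rho> n" by simp
qed

section \<open>Holomorphy of the inner series\<close>

text \<open>The derivative is the termwise one, \<open>D\<close>. The difference quotient minus
  \<open>D\<close> is the pairing with (w - z)/((w - l)(z - l)^2), which is O(|w - z|) because
  \<open>w\<close> and \<open>z\<close> stay away from the circle.\<close>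

lemma inner_psp_series_holomorphic: "holomorphic_into (inner_psp_series \<rho>) unit_disc"
  unfolding holomorphic_into_def
proof
  fix z assume "z \<in> unit_disc"
  then have z: "norm z < 1" by (simp add: unit_disc_def)
  define A where "A = (\<Sum>\<^sub>\<infinity>l\<in>unit_circle. norm (\<rho> l))"
  \<comment> \<open>Half the distance from \<open>z\<close> to the circle: every \<open>w\<close>
    within \<open>d\<close> of \<open>z\<close> is still at distance at least \<open>d\<close> from
    the circle.\<close>
  define d where "d = (1 - norm z) / 2"
  have d: "d > 0" using z by (simp add: d_def)
  have inv_bound: "norm (inverse (w - l)) \<le> inverse d" "w \<noteq> l"
    if "dist w z < d" "l \<in> unit_circle" for w l
  proof -
    have "norm w \<le> norm z + d"
      using that norm_triangle_ineq2[of w z] by (simp add: dist_norm)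
    then have "d \<le> norm (w - l)"
      using that norm_triangle_ineq2[of l w] unfolding d_def
      by (simp add: unit_circle_def norm_minus_commute field_simps)
    then show "norm (inverse (w - l)) \<le> inverse d" "w \<noteq> l"
      using d by (auto simp: norm_inverse le_imp_inverse_le)
  qed
  have zz: "dist z z < d" using d by simp
  define D where "D = circle_pairing \<rho> (\<lambda>l. - (inverse (z - l) * inverse (z - l)))"
  have "norm (inverse (w - z) *\<^sub>C (inner_psp_series \<rho> w - inner_psp_series \<rho> z) - D)
      \<le> norm (w - z) * (inverse d * (inverse d * inverse d)) * A"
    if w: "w \<in> unit_disc" "w \<noteq> z" "dist w z < d" for w
  proof -
    have "inverse (w - z) *\<^sub>C (inner_psp_series \<rho> w - inner_psp_series \<rho> z)
        = inverse (w - z) *\<^sub>C circle_pairing \<rho> (\<lambda>l. inverse (w - l) - inverse (z - l))"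
      using w(1) \<open>z \<in> unit_disc\<close>
      by (simp add: inner_psp_series_def psp_series_eq_circle_pairing
          circle_pairing_diff[OF inv_bound(1)[OF w(3)] inv_bound(1)[OF zz]])
    also have "\<dots> = circle_pairing \<rho> (\<lambda>l. inverse (w - z) * (inverse (w - l) - inverse (z - l)))"
    proof (rule circle_pairing_scale[symmetric, where C = "inverse d + inverse d"])
      fix l assume l: "l \<in> unit_circle"
      show "norm (inverse (w - l) - inverse (z - l)) \<le> inverse d + inverse d"
        using norm_triangle_ineq4[of "inverse (w - l)" "inverse (z - l)"]
          inv_bound(1)[OF w(3) l] inv_bound(1)[OF zz l] by linarith
    qed
    also have "\<dots> = circle_pairing \<rho> (\<lambda>l. - (inverse (w - l) * inverse (z - l)))"
    proof (rule circle_pairing_cong)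
      fix l assume l: "l \<in> unit_circle"
      have "inverse (w - l) - inverse (z - l) = - ((w - z) * (inverse (w - l) * inverse (z - l)))"
        using inv_bound(2)[OF w(3) l] inv_bound(2)[OF zz l] by (simp add: divide_simps)
      then show "inverse (w - z) * (inverse (w - l) - inverse (z - l))
          = - (inverse (w - l) * inverse (z - l))"
        using w(2) by simp
    qed
    also have "\<dots> - D = circle_pairing \<rho> (\<lambda>l. - (inverse (w - l) * inverse (z - l))
        - - (inverse (z - l) * inverse (z - l)))"
      unfolding D_def
    proof (rule circle_pairing_diff[symmetric])
      fix l assume l: "l \<in> unit_circle"
      show "norm (- (inverse (w - l) * inverse (z - l))) \<le> inverse d * inverse d"
        "norm (- (inverse (z - l) * inverse (z - l))) \<le> inverse d * inverse d"
        unfolding norm_minus_cancel norm_mult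
        using inv_bound(1)[OF w(3) l] inv_bound(1)[OF zz l] d by (auto intro!: mult_mono)
    qed
    also have "\<dots> = circle_pairing \<rho>
        (\<lambda>l. (w - z) * (inverse (w - l) * (inverse (z - l) * inverse (z - l))))"
    proof (rule circle_pairing_cong)
      fix l assume l: "l \<in> unit_circle"
      show "- (inverse (w - l) * inverse (z - l)) - - (inverse (z - l) * inverse (z - l))
          = (w - z) * (inverse (w - l) * (inverse (z - l) * inverse (z - l)))"
        using inv_bound(2)[OF w(3) l] inv_bound(2)[OF zz l] by (simp add: divide_simps)
    qed
    also have "norm \<dots> \<le> norm (w - z) * (inverse d * (inverse d * inverse d)) * A"
      unfolding A_def
    proof (rule norm_circle_pairing_le)
      fix l assume l: "l \<in> unit_circle"
      show "norm ((w - z) * (inverse (w - l) * (inverse (z - l) * inverse (z - l))))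
          \<le> norm (w - z) * (inverse d * (inverse d * inverse d))"
        unfolding norm_mult
        using inv_bound(1)[OF w(3) l] inv_bound(1)[OF zz l] d by (intro mult_mono) auto
    qed
    finally show ?thesis .
  qed
  then have "\<forall>\<^sub>F w in at z within unit_disc.
      norm (inverse (w - z) *\<^sub>C (inner_psp_series \<rho> w - inner_psp_series \<rho> z) - D)
      \<le> norm (w - z) * (inverse d * (inverse d * inverse d)) * A"
    using d unfolding eventually_at by blast
  moreover have "((\<lambda>w. norm (w - z) * (inverse d * (inverse d * inverse d)) * A)
      \<longlongrightarrow> 0) (at z within unit_disc)"
    by (intro tendsto_mult_left_zero tendsto_norm_zero LIM_zero tendsto_ident_at)
  ultimately have "((\<lambda>w. inverse (w - z) *\<^sub>C (inner_psp_series \<rho> w - inner_psp_series \<rho> z) - D)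
      \<longlongrightarrow> 0) (at z within unit_disc)"
    by (rule Lim_null_comparison)
  then show "\<exists>D. ((\<lambda>w. inverse (w - z) *\<^sub>C (inner_psp_series \<rho> w - inner_psp_series \<rho> z))
      \<longlongrightarrow> D) (at z within unit_disc)"
    by (blast intro: LIM_zero_cancel)
qed

section \<open>The continuation and its uniqueness\<close>

lemma inner_psp_series_sums:
  "norm z < 1 \<Longrightarrow> (\<lambda>k. z ^ k *\<^sub>C psp_coeff \<rho> (int k)) sums inner_psp_series \<rho> z"
  using psp_coeff_sums by (simp add: inner_psp_series_def unit_disc_def)

lemma rrl_continuation_inner_psp_series:
  "rrl_continuation (inner_psp_series \<rho>) (outer_psp_series \<rho>)"
  unfolding rrl_continuation_def
  using inner_psp_series_holomorphic bounded_psp_coeff inner_psp_series_sums renascent_psp_coeff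
    outer_function_psp_coeff[symmetric]
  by (auto simp: unit_disc_def)

text \<open>A continuation comes with some coefficient sequence \<open>a\<close> and right limit
  \<open>b\<close>. Uniqueness of power series determines \<open>a\<close>, uniqueness of the
  renascent right limit then determines \<open>b\<close>, and \<open>b\<close> determines
  \<open>h\<close>.\<close>

lemma rrl_continuation_inner_psp_series_unique:
  assumes "rrl_continuation (inner_psp_series \<rho>) h"
  shows "h = outer_psp_series \<rho>"
proof -
  obtain a b where a: "bounded (range a)"
    "\<And>z. norm z < 1 \<Longrightarrow> (\<lambda>k. z ^ k *\<^sub>C a k) sums inner_psp_series \<rho> z"
    and b: "renascent_right_limit a b" "h = outer_function b"
    using assms unfolding rrl_continuation_def unit_disc_def by auto
  have "a = (\<lambda>k. psp_coeff \<rho> (int k))"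
    using a(1) bounded_psp_coeff a(2) inner_psp_series_sums by (rule power_series_unique)
  then have "b = psp_coeff \<rho>"
    using b(1) renascent_psp_coeff_unique by simp
  then show ?thesis
    using b(2) outer_function_psp_coeff by simp
qed

end

theorem theorem4p4:
  fixes \<rho> :: "complex \<Rightarrow> 'b::complex_banach"
  assumes "(\<lambda>l. norm (\<rho> l)) summable_on unit_circle"
  shows "uniquely_rrl_continuable (inner_psp_series \<rho>) \<and>
    rrl_continuation (inner_psp_series \<rho>) (outer_psp_series \<rho>)"
  unfolding uniquely_rrl_continuable_def rrl_continuable_def
  using rrl_continuation_inner_psp_series[OF assms]
    rrl_continuation_inner_psp_series_unique[OF assms] by blast

end
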